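(* Let $b\ge 2$ be an integer, let $f,g:\mathbb{N}\to\mathbb{N}$, and let $\alpha\in[0,1)$ be such that its base $b$ digit sequence is the concatenation $w_1w_2w_3\cdots$, where for each $j\ge 1$ the word $w_j$ has length $g(j)b^{f(j)}$ and is a $b$-ary $(f(j),g(j))$-nested semi-perfect necklace. Then for every $N\in\mathbb{N}$ the star discrepancy $D_N^*$ of the sequence $(\{b^n\alpha\})_{n=0,1,\ldots}$ satisfies $$N D_N^*\le \sum_{j=1}^{m-1} f(j)+\sum_{j=1}^{m} g(j)+(b-1)\frac{f(m)^2}{2}+(b-1)f(m)g(m),$$ where $m\in\mathbb{N}$ is such that $\sum_{j=1}^{m-1} g(j)b^{f(j)}\le N<\sum_{j=1}^{m} g(j)b^{f(j)}$.
   Context: $\{x\}$ denotes the fractional part of $x$. For a sequence $(x_n)_{n\ge0}$ in $[0,1)$, the star discrepancy is $D_N^*=\sup_{0<c\le 1}\left|\frac1N\#\{0\le n<N: x_n\in[0,c)\}-c\right|$. A $b$-ary word is a finite sequence over $\{0,1,\ldots,b-1\}$; a necklace is a word considered up to rotation, so occurrences of subwords are counted circularly (including those wrapping around the end). A $b$-ary necklace is $(k,l)$-semi perfect if its length is $lb^k$ and each word of length $k$ occurs in it (circularly) exactly $l$ times. A $b$-ary word $w$ is a $(k,l)$-nested semi-perfect necklace if for each integer $j\in\{1,\ldots,k\}$, each block of $w$ of length $lb^j$ starting at a position congruent to $1$ modulo $lb^j$ is a $(j,l)$-semi perfect necklace. *)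

theory Defs
  imports Complex_Main
begin

definition star_discrepancy :: "(nat \<Rightarrow> real) \<Rightarrow> nat \<Rightarrow> real" where
  "star_discrepancy x N =
     (SUP c\<in>{0<..1}. \<bar>real (card {n. n < N \<and> x n \<in> {0..<c}}) / real N - c\<bar>)"

text \<open>The \<open>n\<close>-th digit after the radix point, counted from 0, in the canonical base-\<open>b\<close> expansion
  of \<open>\<alpha> \<in> [0,1)\<close> (the one without a tail of digits \<open>b - 1\<close>).\<close>

definition base_digit :: "nat \<Rightarrow> real \<Rightarrow> nat \<Rightarrow> nat" where
  "base_digit b \<alpha> n = nat (\<lfloor>real b ^ Suc n * \<alpha>\<rfloor> mod int b)"

definition is_word :: "nat \<Rightarrow> nat list \<Rightarrow> bool" where
  "is_word b w \<longleftrightarrow> set w \<subseteq> {..<b}"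

definition circular_occurrences :: "nat list \<Rightarrow> nat list \<Rightarrow> nat" where
  "circular_occurrences u w =
     card {i. i < length w \<and> (\<forall>t<length u. w ! ((i + t) mod length w) = u ! t)}"

definition semi_perfect :: "nat \<Rightarrow> nat \<Rightarrow> nat \<Rightarrow> nat list \<Rightarrow> bool" where
  "semi_perfect b k l w \<longleftrightarrow>
     is_word b w \<and> length w = l * b ^ k \<and>
     (\<forall>u. is_word b u \<and> length u = k \<longrightarrow> circular_occurrences u w = l)"

text \<open>List positions start at 0, so positions congruent to 1 in the usual numbering of the letters of
  a word are here the multiples of the modulus.\<close>

definition nested_semi_perfect :: "nat \<Rightarrow> nat \<Rightarrow> nat \<Rightarrow> nat list \<Rightarrow> bool" where
  "nested_semi_perfect b k l w \<longleftrightarrow>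
     is_word b w \<and>
     (\<forall>j\<in>{1..k}. \<forall>p. l * b ^ j dvd p \<and> p + l * b ^ j \<le> length w \<longrightarrow>
        semi_perfect b j l (take (l * b ^ j) (drop p w)))"

text \<open>The infinite sequence \<open>d\<close> is the concatenation \<open>w 1 @ w 2 @ w 3 @ \<dots>\<close>; the value \<open>w 0\<close> is
  irrelevant. The second conjunct says that this concatenation is itself infinite; it only excludes
  the case where all but finitely many of the words are empty.\<close>

definition is_concatenation :: "(nat \<Rightarrow> nat) \<Rightarrow> (nat \<Rightarrow> nat list) \<Rightarrow> bool" where
  "is_concatenation d w \<longleftrightarrow>
     (\<forall>J. let v = concat (map w [1..<Suc J]) in map d [0..<length v] = v) \<and>
     (\<forall>n. \<exists>J. n < length (concat (map w [1..<Suc J])))"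

end

(* The first k digits of a point locate it in an interval of length 1 / b^k.  The points of a
   (k,l)-semi-perfect block would, if the block were followed by itself, visit each of these
   intervals exactly l times; what really follows changes the interval of at most k of them.  So a
   block deviates from the expected count by at most l + k.  A partial last word is cut greedily,
   following the base-b digits of its length, into at most b - 1 aligned blocks of length l * b^i for
   every i below f(m), and fewer than l remaining letters. *)

theory Submission imports Defs begin

section \<open>Values of digit strings\<close>

text \<open>Most significant digit first: if the digits are below \<open>b\<close>, the value is the
  index of the interval of length 1 / b^k formed by all points whose expansion begins with
  them.\<close>

primrec horner :: "nat \<Rightarrow> (nat \<Rightarrow> nat) \<Rightarrow> nat \<Rightarrow> nat" where
  "horner b h 0 = 0"
| "horner b h (Suc k) = b * horner b h k + h k"

lemma horner_cong:
  assumes "\<And>t. t < k \<Longrightarrow> h t = h' t"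
  shows "horner b h k = horner b h' k"
  using assms by (induction k) auto

lemma horner_eq_iff:
  assumes "\<And>t. t < k \<Longrightarrow> h t < b" and "\<And>t. t < k \<Longrightarrow> h' t < b"
  shows "horner b h k = horner b h' k \<longleftrightarrow> (\<forall>t<k. h t = h' t)"
  using assms
proof (induction k)
  case (Suc k)
  have lt: "h k < b" "h' k < b"
    using Suc.prems by simp_all
  have "horner b h (Suc k) = horner b h' (Suc k) \<longleftrightarrow> horner b h k = horner b h' k \<and> h k = h' k"
  proof
    assume eq: "horner b h (Suc k) = horner b h' (Suc k)"
    have "horner b h (Suc k) div b = horner b h' (Suc k) div b"
      and "horner b h (Suc k) mod b = horner b h' (Suc k) mod b"
      by (simp_all only: eq)
    with lt show "horner b h k = horner b h' k \<and> h k = h' k"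
      by simp
  qed simp
  with Suc show ?case
    by (auto simp: less_Suc_eq)
qed simp

lemma horner_surj:
  assumes "0 < b" and "v < b ^ k"
  shows "\<exists>h. (\<forall>t. h t < b) \<and> horner b h k = v"
  using assms(2)
proof (induction k arbitrary: v)
  case 0
  with assms(1) show ?case
    by auto
next
  case (Suc k)
  then have "v div b < b ^ k"
    by (simp add: less_mult_imp_div_less mult.commute)
  then obtain h where h: "\<forall>t. h t < b" "horner b h k = v div b"
    using Suc.IH by blast
  define h' where "h' = h(k := v mod b)"
  have "horner b h' k = horner b h k"
    by (rule horner_cong) (simp add: h'_def)
  with h assms(1) have "(\<forall>t. h' t < b) \<and> horner b h' (Suc k) = v"
    by (simp add: h'_def)
  then show ?case
    by blast
qed

text \<open>This is division with remainder by \<open>b\<close>: \<open>base_digit\<close> is by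
  definition the remainder of the left side, and the quotient is the preceding floor because floor(z
  / b) = floor(z) div b.\<close>

lemma floor_base_step:
  assumes "0 < b"
  shows "\<lfloor>real b ^ Suc n * \<alpha>\<rfloor> = int b * \<lfloor>real b ^ n * \<alpha>\<rfloor> + int (base_digit b \<alpha> n)"
proof -
  define y where "y = real b ^ n * \<alpha>"
  have "\<lfloor>real b * y / real b\<rfloor> = \<lfloor>real b * y\<rfloor> div int b"
    using floor_divide_real_eq_div[of "int b" "real b * y"] by simp
  then have "\<lfloor>y\<rfloor> = \<lfloor>real b * y\<rfloor> div int b"
    using assms by simp
  moreover have "real b ^ Suc n * \<alpha> = real b * y"
    by (simp add: y_def mult_ac)
  ultimately show ?thesis
    using assms by (simp add: base_digit_def y_def mult.assoc)
qed

text \<open>Translates the position of an orbit point into digits. Iterating the one-digit step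
  \<open>k\<close> times splits the floor of b^(n+k) * \<alpha> into a multiple of b^k and a
  \<open>k\<close>-digit value; taking the fractional part removes exactly that multiple.\<close>

lemma floor_base_frac:
  assumes "0 < b"
  shows "\<lfloor>real b ^ k * frac (real b ^ n * \<alpha>)\<rfloor> = int (horner b (\<lambda>t. base_digit b \<alpha> (n + t)) k)"
proof -
  have "\<lfloor>real b ^ (n + k) * \<alpha>\<rfloor>
      = int b ^ k * \<lfloor>real b ^ n * \<alpha>\<rfloor> + int (horner b (\<lambda>t. base_digit b \<alpha> (n + t)) k)"
  proof (induction k)
    case (Suc k)
    then show ?case
      using floor_base_step[OF assms, of "n + k" \<alpha>] by (simp add: algebra_simps)
  qed simp
  moreover have "real b ^ k * frac (real b ^ n * \<alpha>)
      = real b ^ (n + k) * \<alpha> - of_int (int b ^ k * \<lfloor>real b ^ n * \<alpha>\<rfloor>)"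
    by (simp add: frac_def algebra_simps power_add)
  ultimately show ?thesis
    by (simp only: floor_diff_of_int)
qed

section \<open>Semi-perfect words\<close>

text \<open>Every \<open>v\<close> below b^k is the value of exactly one word of length
  \<open>k\<close>, so counting circular windows of value \<open>v\<close> amounts to counting the
  occurrences of that word.\<close>

lemma semi_perfect_card_value:
  assumes sp: "semi_perfect b k l w" and "0 < b" and "v < b ^ k"
  shows "card {i. i < length w \<and> horner b (\<lambda>t. w ! ((i + t) mod length w)) k = v} = l"
proof -
  obtain h where h: "\<And>t. h t < b" "horner b h k = v"
    using horner_surj[OF assms(2,3)] by blast
  have digit: "w ! ((i + t) mod length w) < b" if "i < length w" for i t
  proof -
    have "w ! ((i + t) mod length w) \<in> set w"
      using that by (intro nth_mem mod_less_divisor) linarith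
    with sp show ?thesis
      by (auto simp: semi_perfect_def is_word_def)
  qed
  define u where "u = map h [0..<k]"
  have "is_word b u" "length u = k"
    using h by (auto simp: u_def is_word_def)
  with sp have "circular_occurrences u w = l"
    by (simp add: semi_perfect_def)
  moreover have "horner b (\<lambda>t. w ! ((i + t) mod length w)) k = v
      \<longleftrightarrow> (\<forall>t<length u. w ! ((i + t) mod length w) = u ! t)" if "i < length w" for i
    using horner_eq_iff[of k "\<lambda>t. w ! ((i + t) mod length w)" b h] digit[OF that] h
    by (auto simp: u_def)
  ultimately show ?thesis
    by (simp add: circular_occurrences_def cong: conj_cong)
qed

lemma semi_perfect_card_less:
  assumes "semi_perfect b k l w" and "0 < b" and "a \<le> b ^ k"
  shows "card {i. i < length w \<and> horner b (\<lambda>t. w ! ((i + t) mod length w)) k < a} = l * a"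
  using assms(3)
proof (induction a)
  case (Suc a)
  let ?h = "\<lambda>i. horner b (\<lambda>t. w ! ((i + t) mod length w)) k"
  have "{i. i < length w \<and> ?h i < Suc a}
      = {i. i < length w \<and> ?h i < a} \<union> {i. i < length w \<and> ?h i = a}"
    by auto
  moreover have "card ({i. i < length w \<and> ?h i < a} \<union> {i. i < length w \<and> ?h i = a})
      = card {i. i < length w \<and> ?h i < a} + card {i. i < length w \<and> ?h i = a}"
    by (rule card_Un_disjoint) auto
  ultimately show ?case
    using Suc semi_perfect_card_value[OF assms(1,2), of a] by simp
qed simp

text \<open>Extends the definition to level 0, which the greedy cutting reaches: there a block has
  \<open>l\<close> letters, and the empty word occurs at each of its \<open>l\<close>
  positions.\<close>

lemma nested_semi_perfect_block:
  assumes "nested_semi_perfect b k l w" and "j \<le> k"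
    and "l * b ^ j dvd p" and "p + l * b ^ j \<le> length w"
  shows "semi_perfect b j l (take (l * b ^ j) (drop p w))"
proof (cases "j = 0")
  case True
  have "is_word b (take l (drop p w))"
    using assms(1) set_take_subset[of l "drop p w"] set_drop_subset[of p w]
    unfolding nested_semi_perfect_def is_word_def by blast
  with True assms(4) show ?thesis
    by (simp add: semi_perfect_def circular_occurrences_def)
next
  case False
  with assms show ?thesis
    by (simp add: nested_semi_perfect_def)
qed

section \<open>Discrepancy of blocks\<close>

text \<open>Kept signed, not divided by the length, and with a free starting point \<open>P\<close>,
  so that it is additive over adjacent stretches of the orbit.\<close>

definition count_deviation :: "(nat \<Rightarrow> real) \<Rightarrow> real \<Rightarrow> nat \<Rightarrow> nat \<Rightarrow> real" where
  "count_deviation x c P L = real (card {i. i < L \<and> x (P + i) < c}) - real L * c"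

lemma count_deviation_add:
  "count_deviation x c P (L + M) = count_deviation x c P L + count_deviation x c (P + L) M"
proof -
  let ?B = "{i. i < M \<and> x (P + L + i) < c}"
  have "{i. i < L + M \<and> x (P + i) < c} = {i. i < L \<and> x (P + i) < c} \<union> (+) L ` ?B"
  proof (intro equalityI subsetI)
    fix i assume i: "i \<in> {i. i < L + M \<and> x (P + i) < c}"
    show "i \<in> {i. i < L \<and> x (P + i) < c} \<union> (+) L ` ?B"
    proof (cases "i < L")
      case False
      with i have "i - L \<in> ?B" and "i = L + (i - L)"
        by auto
      then show ?thesis
        by blast
    qed (use i in simp)
  qed (auto simp: add.assoc)
  moreover have "card ({i. i < L \<and> x (P + i) < c} \<union> (+) L ` ?B)
      = card {i. i < L \<and> x (P + i) < c} + card ?B"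
    by (subst card_Un_disjoint) (auto simp: card_image)
  ultimately show ?thesis
    by (simp add: count_deviation_def algebra_simps)
qed

lemma abs_count_deviation_le_length:
  assumes "0 \<le> c" and "c \<le> 1"
  shows "\<bar>count_deviation x c P L\<bar> \<le> real L"
proof -
  have "card {i. i < L \<and> x (P + i) < c} \<le> card {..<L}"
    by (rule card_mono) auto
  moreover have "0 \<le> real L * c" "real L * c \<le> real L"
    using assms by (simp_all add: mult_left_le)
  ultimately show ?thesis
    unfolding count_deviation_def by auto
qed

lemma semi_perfect_count_deviation:
  assumes sp: "semi_perfect b k l w" and b: "0 < b" and c: "0 \<le> c" "c \<le> 1"
    and digits: "\<And>i. i < length w \<Longrightarrow> base_digit b \<alpha> (P + i) = w ! i"
  shows "\<bar>count_deviation (\<lambda>n. frac (real b ^ n * \<alpha>)) c P (length w)\<bar> \<le> real l + real k"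
proof -
  let ?x = "\<lambda>n. frac (real b ^ n * \<alpha>)"
  let ?L = "length w"
  define h where "h i = horner b (\<lambda>t. w ! ((i + t) mod ?L)) k" for i
  \<comment> \<open>This choice gives a / b^k \<le> c < (a + 1) / b^k, so intervals of index below
    \<open>a\<close> lie entirely below \<open>c\<close>, and a point below \<open>c\<close> has
    index at most \<open>a\<close>.\<close>
  define a where "a = nat \<lfloor>real b ^ k * c\<rfloor>"
  define S where "S = {i. i < ?L \<and> ?x (P + i) < c}"
  \<comment> \<open>Here the window of \<open>k\<close> letters runs past the end of the block, so
    the circular word and the true digits may disagree. Nothing is assumed about the digits after
    the block.\<close>
  define T where "T = {i. i < ?L \<and> ?L < i + k}"
  have len: "?L = l * b ^ k"
    using sp by (simp add: semi_perfect_def)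
  have a_floor: "int a = \<lfloor>real b ^ k * c\<rfloor>"
    using c by (simp add: a_def)
  have a_le: "real a \<le> real b ^ k * c" and a_gt: "real b ^ k * c < real a + 1"
    using a_floor by linarith+
  have "a \<le> b ^ k"
  proof -
    have "real b ^ k * c \<le> real b ^ k"
      using c by (simp add: mult_left_le)
    with a_le have "real a \<le> real (b ^ k)"
      by (simp only: of_nat_power)
    then show ?thesis
      by (simp only: of_nat_le_iff)
  qed
  have finite [simp]: "finite S" "finite T" "finite {i. i < ?L \<and> h i < r}" for r
    by (auto simp: S_def T_def)
  have "card T \<le> card {?L - k..<?L}"
    by (rule card_mono) (auto simp: T_def)
  then have card_T: "card T \<le> k"
    by simp
  have h_floor: "\<lfloor>real b ^ k * ?x (P + i)\<rfloor> = int (h i)" if "i < ?L" "i \<notin> T" for i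
  proof -
    have "horner b (\<lambda>t. base_digit b \<alpha> (P + i + t)) k = h i"
      unfolding h_def using that
      by (intro horner_cong) (simp add: T_def add.assoc digits)
    then show ?thesis
      by (simp add: floor_base_frac[OF b])
  qed
  have bk: "0 < real b ^ k"
    using b by simp
  have "{i. i < ?L \<and> h i < a} \<subseteq> S \<union> T"
  proof
    fix i assume i: "i \<in> {i. i < ?L \<and> h i < a}"
    show "i \<in> S \<union> T"
    proof (cases "i \<in> T")
      case False
      \<comment> \<open>The right end of the interval of index \<open>h i\<close> is at most a /
        b^k, hence at most \<open>c\<close>.\<close>
      have "real b ^ k * ?x (P + i) < real (h i) + 1"
        using h_floor[of i] i False by (simp, linarith)
      also have "\<dots> \<le> real a"
        using i by simp
      also note a_le
      finally have "?x (P + i) < c"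
        using bk by (simp only: mult_less_cancel_left_pos)
      with i show ?thesis
        by (simp add: S_def)
    qed simp
  qed
  then have "card {i. i < ?L \<and> h i < a} \<le> card S + card T"
    by (intro order.trans[OF card_mono card_Un_le]) simp_all
  then have lower: "l * a \<le> card S + k"
    using semi_perfect_card_less[OF sp b \<open>a \<le> b ^ k\<close>] card_T by (simp add: h_def)
  have upper: "card S \<le> l * Suc a + k"
  \<comment> \<open>Equality occurs only for c = 1. Then a + 1 exceeds the number of intervals, and
    the length of the block serves as the bound.\<close>
  proof (cases "a = b ^ k")
    case True
    have "card S \<le> card {..<?L}"
      by (rule card_mono) (auto simp: S_def)
    with True len show ?thesis
      by simp
  next
    case False
    with \<open>a \<le> b ^ k\<close> have a_less: "Suc a \<le> b ^ k"
      by simp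
    have "S \<subseteq> {i. i < ?L \<and> h i < Suc a} \<union> T"
    proof
      fix i assume i: "i \<in> S"
      show "i \<in> {i. i < ?L \<and> h i < Suc a} \<union> T"
      proof (cases "i \<in> T")
        case False
        have "real b ^ k * ?x (P + i) \<le> real b ^ k * c"
          using i by (intro mult_left_mono) (auto simp: S_def)
        then have "\<lfloor>real b ^ k * ?x (P + i)\<rfloor> \<le> int a"
          unfolding a_floor by (rule floor_mono)
        then have "h i \<le> a"
          using h_floor[of i] i False by (simp add: S_def)
        with i show ?thesis
          by (simp add: S_def)
      qed simp
    qed
    then have "card S \<le> card {i. i < ?L \<and> h i < Suc a} + card T"
      by (intro order.trans[OF card_mono card_Un_le]) simp_all
    then show ?thesis
      using semi_perfect_card_less[OF sp b a_less] card_T by (simp add: h_def)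
  qed
  \<comment> \<open>The expected count l * b^k * c lies between l * a and l * (a + 1), and the true
    count lies in the same range widened by \<open>k\<close> on both sides.\<close>
  have "real l * real a \<le> real l * (real b ^ k * c)"
    and "real l * (real b ^ k * c) \<le> real l * (real a + 1)"
    using a_le a_gt by (auto intro: mult_left_mono)
  moreover have "real l * real a \<le> real (card S) + real k"
    using lower by (metis of_nat_add of_nat_le_iff of_nat_mult)
  moreover have "real (card S) \<le> real l * (real a + 1) + real k"
    using of_nat_mono[OF upper, where 'a = real] by (simp add: algebra_simps)
  ultimately show ?thesis
    unfolding count_deviation_def S_def[symmetric] by (simp add: len algebra_simps abs_le_iff)
qed

lemma nested_count_deviation_block:
  assumes nested: "nested_semi_perfect b k l w" and b: "0 < b" and c: "0 \<le> c" "c \<le> 1"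
    and digits: "\<And>i. i < length w \<Longrightarrow> base_digit b \<alpha> (P + i) = w ! i"
    and p: "j \<le> k" "l * b ^ j dvd p" "p + l * b ^ j \<le> length w"
  shows "\<bar>count_deviation (\<lambda>n. frac (real b ^ n * \<alpha>)) c (P + p) (l * b ^ j)\<bar> \<le> real l + real j"
proof -
  let ?v = "take (l * b ^ j) (drop p w)"
  have len: "length ?v = l * b ^ j"
    using p(3) by simp
  have "\<bar>count_deviation (\<lambda>n. frac (real b ^ n * \<alpha>)) c (P + p) (length ?v)\<bar> \<le> real l + real j"
  proof (rule semi_perfect_count_deviation[OF nested_semi_perfect_block[OF nested p] b c])
    fix i assume "i < length ?v"
    then show "base_digit b \<alpha> (P + p + i) = ?v ! i"
      using digits[of "p + i"] p(3) by (simp add: add.assoc)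
  qed
  then show ?thesis
    by (simp only: len)
qed

text \<open>Induction on \<open>j\<close>, with \<open>p\<close> and \<open>R\<close> free because
  the remainder is an initial piece of a smaller aligned block. The whole block at \<open>p\<close>
  has to fit into \<open>w\<close>, although only \<open>R\<close> letters are counted, so that all
  smaller blocks inside it fit too. At level 0 fewer than \<open>l\<close> letters remain, and the
  trivial bound yields the single summand \<open>l\<close>.\<close>

lemma nested_count_deviation_partial:
  assumes nested: "nested_semi_perfect b k l w" and b: "0 < b" and c: "0 \<le> c" "c \<le> 1"
    and digits: "\<And>i. i < length w \<Longrightarrow> base_digit b \<alpha> (P + i) = w ! i"
    and "j \<le> k" "l * b ^ j dvd p" "p + l * b ^ j \<le> length w" "R < l * b ^ j"
  shows "\<bar>count_deviation (\<lambda>n. frac (real b ^ n * \<alpha>)) c (P + p) R\<bar>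
    \<le> real l + (\<Sum>i<j. (real b - 1) * (real l + real i))"
  using assms(6-9)
proof (induction j arbitrary: p R)
  case 0
  then show ?case
    using abs_count_deviation_le_length[OF c, of "\<lambda>n. frac (real b ^ n * \<alpha>)" "P + p" R] by simp
next
  case (Suc j)
  let ?dev = "count_deviation (\<lambda>n. frac (real b ^ n * \<alpha>)) c"
  define M where "M = l * b ^ j"
  define q where "q = R div M"
  have M_Suc: "l * b ^ Suc j = b * M"
    by (simp add: M_def)
  have R: "R = q * M + R mod M"
    by (simp add: q_def)
  \<comment> \<open>The strict bound on \<open>R\<close> rules out l = 0, so that the remainder
    modulo \<open>M\<close> is smaller than \<open>M\<close>.\<close>
  have "M > 0"
    using Suc.prems(4) unfolding M_Suc by (cases "M = 0") simp_all
  have "q < b"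
    using Suc.prems(4) unfolding q_def M_Suc by (rule less_mult_imp_div_less)
  have "M dvd p"
    using Suc.prems(2) unfolding M_Suc by (rule dvd_mult_right)
  \<comment> \<open>The case s = q matters as well: the remainder starts there, and the induction
    hypothesis asks for a full block of length \<open>M\<close> at that place.\<close>
  have fits: "p + s * M + M \<le> length w" if "s < b" for s
  proof -
    have "Suc s * M \<le> b * M"
      using that by (intro mult_le_mono1) simp
    with Suc.prems(3) show ?thesis
      unfolding M_Suc by simp
  qed
  have full: "\<bar>?dev (P + p) (s * M)\<bar> \<le> real s * (real l + real j)" if "s \<le> b" for s
    using that
  proof (induction s)
    case 0
    then show ?case
      by (simp add: count_deviation_def)
  next
    case (Suc s)
    have "\<bar>?dev (P + (p + s * M)) (l * b ^ j)\<bar> \<le> real l + real j"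
      using Suc.prems \<open>Suc j \<le> k\<close> \<open>M dvd p\<close> fits[of s]
      by (intro nested_count_deviation_block[OF nested b c digits]) (simp_all add: M_def)
    moreover have "?dev (P + p) (Suc s * M) = ?dev (P + p) (s * M) + ?dev (P + (p + s * M)) M"
      using count_deviation_add[of _ c "P + p" "s * M" M] by (simp add: add_ac)
    moreover have "\<bar>?dev (P + p) (s * M)\<bar> \<le> real s * (real l + real j)"
      using Suc by simp
    ultimately show ?case
      by (simp add: M_def algebra_simps)
  qed
  have "\<bar>?dev (P + (p + q * M)) (R mod M)\<bar>
      \<le> real l + (\<Sum>i<j. (real b - 1) * (real l + real i))"
    using Suc.prems(1) \<open>M dvd p\<close> fits[OF \<open>q < b\<close>] \<open>M > 0\<close>
    by (intro Suc.IH) (simp_all add: M_def)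
  moreover have "\<bar>?dev (P + p) (q * M)\<bar> \<le> (real b - 1) * (real l + real j)"
  proof -
    have "real q \<le> real b - 1"
      using \<open>q < b\<close> by linarith
    then have "real q * (real l + real j) \<le> (real b - 1) * (real l + real j)"
      by (intro mult_right_mono) simp_all
    with full[of q] \<open>q < b\<close> show ?thesis
      by linarith
  qed
  moreover have "?dev (P + p) R = ?dev (P + p) (q * M) + ?dev (P + (p + q * M)) (R mod M)"
    using count_deviation_add[of _ c "P + p" "q * M" "R mod M"] by (simp add: q_def add_ac)
  ultimately show ?case
    by simp
qed

section \<open>Concatenations\<close>

text \<open>Obtained by reading the prefix property for one word more at a position just beyond the
  first \<open>J\<close> words.\<close>

lemma is_concatenation_nth:
  assumes "is_concatenation d w" and "i < length (w (Suc J))"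
  shows "d (length (concat (map w [1..<Suc J])) + i) = w (Suc J) ! i"
proof -
  let ?v = "concat (map w [1..<Suc J])"
  let ?v' = "concat (map w [1..<Suc (Suc J)])"
  have v': "?v' = ?v @ w (Suc J)"
    by simp
  have "map d [0..<length ?v'] = ?v'"
    using assms(1) unfolding is_concatenation_def Let_def by blast
  then have "map d [0..<length ?v'] ! (length ?v + i) = ?v' ! (length ?v + i)"
    by (rule arg_cong)
  with assms(2) show ?thesis
    unfolding v' by (simp add: nth_append)
qed

lemma length_concat_words:
  assumes "\<And>j. j \<ge> 1 \<Longrightarrow> length (w j) = s j"
  shows "length (concat (map w [1..<Suc J])) = (\<Sum>j=1..<Suc J. s j)"
  by (induction J) (simp_all add: assms)

section \<open>Adding up the words before position \<open>N\<close> and passing to the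
  supremum\<close>

theorem theorem1:
  fixes b :: nat and f g :: "nat \<Rightarrow> nat" and \<alpha> :: real
    and w :: "nat \<Rightarrow> nat list" and N m :: nat
  assumes "b \<ge> 2"
    and "0 \<le> \<alpha>" and "\<alpha> < 1"
    and "\<And>j. j \<ge> 1 \<Longrightarrow> length (w j) = g j * b ^ f j"
    and "\<And>j. j \<ge> 1 \<Longrightarrow> nested_semi_perfect b (f j) (g j) (w j)"
    and "is_concatenation (base_digit b \<alpha>) w"
    and "(\<Sum>j=1..<m. g j * b ^ f j) \<le> N"
    and "N < (\<Sum>j=1..m. g j * b ^ f j)"
  shows "real N * star_discrepancy (\<lambda>n. frac (real b ^ n * \<alpha>)) N
    \<le> (\<Sum>j=1..<m. real (f j)) + (\<Sum>j=1..m. real (g j))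
      + (real b - 1) * (real (f m))\<^sup>2 / 2 + (real b - 1) * real (f m) * real (g m)"
proof -
  let ?x = "\<lambda>n. frac (real b ^ n * \<alpha>)"
  define B where "B = (\<Sum>j=1..<m. real (f j)) + (\<Sum>j=1..m. real (g j))
      + (real b - 1) * (real (f m))\<^sup>2 / 2 + (real b - 1) * real (f m) * real (g m)"
  define s where "s J = (\<Sum>j=1..<Suc J. g j * b ^ f j)" for J
  have b: "0 < b"
    using assms(1) by simp
  have digits: "base_digit b \<alpha> (s J + i) = w (Suc J) ! i" if "i < length (w (Suc J))" for i J
    using is_concatenation_nth[OF assms(6) that]
    by (simp only: length_concat_words[of w, OF assms(4)] s_def)
  \<comment> \<open>For m = 0 the sum that exceeds \<open>N\<close> would be empty.\<close>
  obtain J where m: "m = Suc J"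
    using assms(8) by (cases m) auto
  have dev: "\<bar>count_deviation ?x c 0 N\<bar> \<le> B" if c: "0 \<le> c" "c \<le> 1" for c
  proof -
    \<comment> \<open>A complete word is its own aligned block of top level, starting at offset 0,
      so it costs only f + g.\<close>
    have complete: "\<bar>count_deviation ?x c 0 (s K)\<bar> \<le> (\<Sum>j=1..<Suc K. real (f j) + real (g j))" for K
    proof (induction K)
      case 0
      then show ?case
        by (simp add: s_def count_deviation_def)
    next
      case (Suc K)
      have "\<bar>count_deviation ?x c (s K + 0) (g (Suc K) * b ^ f (Suc K))\<bar>
          \<le> real (g (Suc K)) + real (f (Suc K))"
        by (rule nested_count_deviation_block[OF assms(5)[of "Suc K"] b c digits])
          (simp_all add: assms(4))
      moreover have "s (Suc K) = s K + g (Suc K) * b ^ f (Suc K)"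
        by (simp add: s_def)
      ultimately show ?case
        using Suc count_deviation_add[of ?x c 0 "s K"] by simp
    qed
    define R where "R = N - s J"
    have N: "N = s J + R"
      using assms(7) by (simp add: R_def s_def m)
    have "(\<Sum>j=1..m. g j * b ^ f j) = s J + g m * b ^ f m"
      by (simp add: s_def m atLeastLessThanSuc_atLeastAtMost)
    with N assms(8) have "R < g m * b ^ f m"
      by simp
    then have "\<bar>count_deviation ?x c (s J + 0) R\<bar>
        \<le> real (g m) + (\<Sum>i<f m. (real b - 1) * (real (g m) + real i))"
      unfolding m
      by (intro nested_count_deviation_partial[OF assms(5)[of "Suc J"] b c digits])
        (simp_all add: assms(4))
    moreover have "(\<Sum>i<n. (real b - 1) * (r + real i))
        = (real b - 1) * (real n * (real n - 1) / 2) + (real b - 1) * real n * r" for n r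
      by (induction n) (simp_all add: field_simps)
    \<comment> \<open>The sum over levels produces f(m) * (f(m) - 1) / 2, which is relaxed to f(m)^2
      / 2 to match the stated bound.\<close>
    moreover have "(real b - 1) * (real (f m) * (real (f m) - 1) / 2)
        \<le> (real b - 1) * ((real (f m))\<^sup>2 / 2)"
      using b by (intro mult_left_mono) (simp_all add: power2_eq_square algebra_simps)
    \<comment> \<open>The letters left over in the unfinished word contribute g(m) but no f(m),
      which is why the two sums end at different indices.\<close>
    moreover have "(\<Sum>j=1..<Suc J. real (f j) + real (g j)) + real (g m)
        = (\<Sum>j=1..<m. real (f j)) + (\<Sum>j=1..m. real (g j))"
      by (simp add: m sum.distrib atLeastLessThanSuc_atLeastAtMost)
    ultimately show ?thesis
      using complete[of J] count_deviation_add[of ?x c 0 "s J" R]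
      unfolding B_def N by simp
  qed
  have "real N * star_discrepancy ?x N \<le> B"
  proof (cases "N = 0")
    \<comment> \<open>The left side vanishes whatever value the discrepancy takes, and
      \<open>B\<close> is nonnegative because it bounds an absolute value.\<close>
    case True
    with dev[of 0] show ?thesis
      by simp
  next
    case False
    have "star_discrepancy ?x N \<le> B / real N"
      unfolding star_discrepancy_def
    \<comment> \<open>As \<open>B\<close> does not depend on \<open>c\<close>, a pointwise estimate
      on the nonempty index set is enough.\<close>
    proof (rule cSUP_least)
      fix c :: real assume c: "c \<in> {0<..1}"
      have "{n. n < N \<and> ?x n \<in> {0..<c}} = {n. n < N \<and> ?x n < c}"
        by (auto simp: frac_ge_0)
      then have "real (card {n. n < N \<and> ?x n \<in> {0..<c}}) / real N - c
          = count_deviation ?x c 0 N / real N"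
        using False by (simp add: count_deviation_def field_simps)
      with dev[of c] c show "\<bar>real (card {n. n < N \<and> ?x n \<in> {0..<c}}) / real N - c\<bar> \<le> B / real N"
        by (simp add: divide_right_mono)
    qed simp
    with False show ?thesis
      by (simp add: field_simps)
  qed
  then show ?thesis
    by (simp only: B_def)
qed

end
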